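(* Let $X$ be a real Hilbert space, let $A$ be a closed affine subspace of $X$ with parallel space $U := A - A$, and let $H$ be the hyperplane $$H := \{x \in X : \langle x, c\rangle = \gamma\},$$ where $c \in X \smallsetminus \{0\}$ and $\gamma \in \mathbb{R}$. Let $x \in X$. Then exactly one of the following holds: (i) $P_U(c) = 0$, $\langle P_A(x), c\rangle = \gamma$, $A \cap H \neq \varnothing$, and $P_{A \cap H}(x) = P_A(x)$. (ii) $P_U(c) = 0$, $\langle P_A(x), c\rangle \neq \gamma$, $A \cap H = \varnothing$, and $P_{\operatorname{Fix}(P_A P_H)}(x) = P_A(x)$. (iii) $P_U(c) \neq 0$, $A \cap H \neq \varnothing$, and $$P_{A \cap H}(x) = P_A(x) + \frac{\gamma - \langle P_A(x), c\rangle}{\|P_U(c)\|^2}\, P_U(c).$$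
   Context: $\langle\cdot,\cdot\rangle$ is the inner product of $X$ and $\|\cdot\|$ the induced norm. A closed affine subspace is a translate of a closed linear subspace (in particular, it is nonempty); $A - A = \{a - a' : a, a' \in A\}$ is the closed linear subspace parallel to $A$. For a nonempty closed convex set $C \subseteq X$, $P_C : X \to X$ denotes the nearest point mapping (orthogonal projection) onto $C$. $\operatorname{Fix}(P_A P_H) := \{x \in X : x = P_A(P_H(x))\}$. *)

theory Defs
  imports "HOL-Analysis.Analysis"
begin

definition closed_affine_subspace :: "'a::real_normed_vector set \<Rightarrow> bool" where
  "closed_affine_subspace A \<longleftrightarrow> (\<exists>a V. subspace V \<and> closed V \<and> A = (\<lambda>v. a + v) ` V)"

(* The library's closest_point is restricted to class heine_borel, i.e. to finite dimension.
   The value of proj C x is meaningful only if C has a unique point nearest to x; the lemma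
   proj_ex1 below shows that this holds for nonempty closed convex C in a Hilbert space. *)
definition proj :: "'a::real_inner set \<Rightarrow> 'a \<Rightarrow> 'a" where
  "proj C x = (THE p. p \<in> C \<and> (\<forall>y\<in>C. dist x p \<le> dist x y))"

definition Fix :: "('a \<Rightarrow> 'a) \<Rightarrow> 'a set" where
  "Fix T = {x. x = T x}"

definition exactly_one3 :: "bool \<Rightarrow> bool \<Rightarrow> bool \<Rightarrow> bool" where
  "exactly_one3 P Q R \<longleftrightarrow> (P \<or> Q \<or> R) \<and> \<not> (P \<and> Q) \<and> \<not> (P \<and> R) \<and> \<not> (Q \<and> R)"

lemma dist_midpoint_bound:
  fixes x :: "'a::real_inner"
  assumes "convex C" "u \<in> C" "v \<in> C" "\<And>y. y \<in> C \<Longrightarrow> d \<le> dist x y" "0 \<le> d"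
  shows "(dist u v)\<^sup>2 \<le> 2 * (dist x u)\<^sup>2 + 2 * (dist x v)\<^sup>2 - 4 * d\<^sup>2"
proof -
  define m where "m = (1/2) *\<^sub>R u + (1/2) *\<^sub>R v"
  have "m \<in> C" unfolding m_def using assms by (intro convexD) auto
  then have "d\<^sup>2 \<le> (dist x m)\<^sup>2" using assms by (simp add: power_mono)
  moreover have "(dist u v)\<^sup>2 = 2 * (dist x u)\<^sup>2 + 2 * (dist x v)\<^sup>2 - 4 * (dist x m)\<^sup>2"
    unfolding m_def dist_norm power2_norm_eq_inner
    by (simp add: inner_diff inner_add inner_commute algebra_simps)
  ultimately show ?thesis by linarith
qed

lemma proj_ex1:
  fixes C :: "'a::{real_inner,complete_space} set"
  assumes "C \<noteq> {}" "closed C" "convex C"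
  shows "\<exists>!p. p \<in> C \<and> (\<forall>y\<in>C. dist x p \<le> dist x y)"
proof -
  define d where "d = infdist x C"
  have d0: "0 \<le> d" by (simp add: d_def infdist_nonneg)
  have dle: "d \<le> dist x y" if "y \<in> C" for y using that by (simp add: d_def infdist_le)
  define r where "r n = 1 / real (Suc n)" for n
  have r0: "0 < r n" for n by (simp add: r_def)
  define S where "S n = C \<inter> cball x (d + r n)" for n
  have lim: "(\<lambda>n. 4 * (r n * (2 * d + r n))) \<longlonglongrightarrow> 4 * (0 * (2 * d + 0))"
    unfolding r_def by (intro tendsto_intros LIMSEQ_Suc[OF lim_1_over_n])
  obtain p where p: "\<And>n. p \<in> S n"
  proof (rule decreasing_closed_nest[of S])
    show "closed (S n)" for n using assms by (simp add: S_def closed_Int)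
    show "S n \<noteq> {}" for n
    proof -
      have "\<exists>y\<in>C. dist x y < d + r n"
      proof (rule ccontr)
        assume "\<not> ?thesis"
        then have "d + r n \<le> infdist x C"
          using assms(1) by (auto simp: infdist_def not_less intro!: cINF_greatest)
        then show False using r0[of n] by (simp add: d_def)
      qed
      then show ?thesis unfolding S_def by (meson disjoint_iff less_imp_le mem_cball)
    qed
    show "S n \<subseteq> S m" if "m \<le> n" for m n
    proof -
      have "r n \<le> r m" using that by (simp add: r_def frac_le)
      then show ?thesis by (auto simp: S_def)
    qed
    show "\<exists>n. \<forall>u\<in>S n. \<forall>v\<in>S n. dist u v < e" if "0 < e" for e
    proof -
      have "eventually (\<lambda>n. 4 * (r n * (2 * d + r n)) < e\<^sup>2) sequentially"
        using that by (intro order_tendstoD(2)[OF lim]) simp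
      then obtain n where n: "4 * (r n * (2 * d + r n)) < e\<^sup>2"
        by (auto simp: eventually_sequentially)
      have "dist u v < e" if "u \<in> S n" "v \<in> S n" for u v
      proof -
        have "(dist x u)\<^sup>2 \<le> (d + r n)\<^sup>2" "(dist x v)\<^sup>2 \<le> (d + r n)\<^sup>2"
          using that by (auto simp: S_def intro!: power_mono)
        moreover have "(dist u v)\<^sup>2 \<le> 2 * (dist x u)\<^sup>2 + 2 * (dist x v)\<^sup>2 - 4 * d\<^sup>2"
          using that dle d0 assms by (intro dist_midpoint_bound[of C]) (auto simp: S_def)
        moreover have "4 * (d + r n)\<^sup>2 - 4 * d\<^sup>2 = 4 * (r n * (2 * d + r n))"
          by (simp add: power2_eq_square algebra_simps)
        ultimately have "(dist u v)\<^sup>2 < e\<^sup>2" using n by linarith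
        then show ?thesis using \<open>0 < e\<close> by (simp add: power_less_imp_less_base)
      qed
      then show ?thesis by blast
    qed
  qed blast
  have pC: "p \<in> C" using p by (auto simp: S_def)
  have "(\<lambda>n. d + r n) \<longlonglongrightarrow> d + 0"
    unfolding r_def by (intro tendsto_intros LIMSEQ_Suc[OF lim_1_over_n])
  then have pd: "dist x p \<le> d"
    using p by (intro LIMSEQ_le_const[of _ d]) (auto simp: S_def)
  show ?thesis
  proof (rule ex1I[of _ p])
    show "p \<in> C \<and> (\<forall>y\<in>C. dist x p \<le> dist x y)" using pC order_trans[OF pd dle] by blast
    fix q assume q: "q \<in> C \<and> (\<forall>y\<in>C. dist x q \<le> dist x y)"
    have "dist x p = d" using dle[OF pC] pd by linarith
    moreover from q have "d \<le> dist x q" "dist x q \<le> dist x p" using dle pC by blast+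
    ultimately have "dist x p = d" "dist x q = d" using pd by linarith+
    then have "(dist q p)\<^sup>2 \<le> 0"
      using dist_midpoint_bound[OF assms(3) _ pC dle d0, of q] q by simp
    then show "q = p" by (simp only: power2_less_eq_zero_iff dist_eq_0_iff)
  qed
qed

end

theory Submission
  imports Defs
begin

text \<open>
  Put \<open>p = proj A x\<close> and \<open>d = proj U c\<close>. Everything rests on the variational description of the
  projection onto an affine subspace: \<open>p\<close> is the point of \<open>A\<close> for which \<open>x - p\<close> is orthogonal to
  the directions of \<open>A\<close> (lemmas \<open>proj_eqI\<close> and \<open>proj_closed_affine_subspace\<close>). Applied to
  \<open>U\<close> and \<open>c\<close>, it gives \<open>v \<bullet> c = v \<bullet> d\<close> for every \<open>v \<in> U\<close>, so inside \<open>A\<close> the hyperplane \<open>H\<close> is seen only through \<open>d\<close>.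

  If \<open>d = 0\<close>, the functional \<open>\<lambda>y. y \<bullet> c\<close> is constant on \<open>A\<close>. Either its value there is \<open>\<gamma>\<close> and
  \<open>A \<subseteq> H\<close>, or it is not and \<open>A\<close> misses \<open>H\<close>. In the latter case projecting a point of \<open>A\<close> onto \<open>H\<close>
  moves it along \<open>c\<close>, which is orthogonal to \<open>U\<close>, and projecting back onto \<open>A\<close> undoes the move;
  hence the fixed point set of the composition is \<open>A\<close> itself.

  If \<open>d \<noteq> 0\<close>, moving from \<open>p\<close> along \<open>d\<close> stays in \<open>A\<close> and changes the value of \<open>\<lambda>y. y \<bullet> c\<close> at the rate
  \<open>d \<bullet> c = d \<bullet> d\<close>, so the stated multiple of \<open>d\<close> reaches \<open>H\<close>. The directions of \<open>A \<inter> H\<close> are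
  those \<open>v \<in> U\<close> with \<open>v \<bullet> d = 0\<close>; they are orthogonal to \<open>x - p\<close> and to \<open>d\<close>, which is the criterion
  for the point reached to be the projection of \<open>x\<close> onto \<open>A \<inter> H\<close>.
\<close>

text \<open>By Pythagoras, \<open>(dist x y)\<^sup>2 = (dist x p)\<^sup>2 + (dist p y)\<^sup>2\<close> for all \<open>y \<in> C\<close>, so \<open>p\<close> is the unique
  nearest point.\<close>

lemma proj_eqI:
  fixes x p :: "'a::real_inner"
  assumes "p \<in> C" and orth: "\<And>y. y \<in> C \<Longrightarrow> (x - p) \<bullet> (y - p) = 0"
  shows "proj C x = p"
proof -
  have pyth: "(dist x y)\<^sup>2 = (dist x p)\<^sup>2 + (dist p y)\<^sup>2" if "y \<in> C" for y
  proof -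
    have "orthogonal (x - p) (p - y)"
      using orth[OF that] by (simp add: orthogonal_def inner_diff_right)
    from norm_add_Pythagorean[OF this] show ?thesis
      by (simp add: dist_norm)
  qed
  show ?thesis
    unfolding proj_def
  proof (rule the_equality)
    have "dist x p \<le> dist x y" if "y \<in> C" for y
      using pyth[OF that] by (simp add: power2_le_imp_le)
    then show "p \<in> C \<and> (\<forall>y\<in>C. dist x p \<le> dist x y)"
      using assms(1) by blast
  next
    fix q assume q: "q \<in> C \<and> (\<forall>y\<in>C. dist x q \<le> dist x y)"
    then have "(dist x q)\<^sup>2 \<le> (dist x p)\<^sup>2"
      using assms(1) by (simp add: power_mono)
    then have "(dist p q)\<^sup>2 \<le> 0"
      using pyth[of q] q by simp
    then show "q = p"
      by simp
  qed
qed

text \<open>The vector from the nearest point of a convex set to \<open>x\<close> has nonpositive inner product with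
  every direction into the set; for an affine set both \<open>v\<close> and \<open>-v\<close> are such directions.\<close>

lemma proj_closed_affine_subspace:
  fixes x :: "'a::{real_inner,complete_space}"
  assumes V: "subspace V" "closed V" and A: "A = (+) a ` V"
  shows "proj A x \<in> A" and "\<And>v. v \<in> V \<Longrightarrow> (x - proj A x) \<bullet> v = 0"
proof -
  have A_prop: "A \<noteq> {}" "closed A" "convex A"
    using V subspace_0[OF V(1)]
    by (auto simp: A closed_translation convex_translation subspace_imp_convex)
  have near: "proj A x \<in> A \<and> (\<forall>y\<in>A. dist x (proj A x) \<le> dist x y)"
    unfolding proj_def by (rule theI'[OF proj_ex1[OF A_prop]])
  then show pA: "proj A x \<in> A"
    by blast
  fix v assume v: "v \<in> V"
  have le: "(x - proj A x) \<bullet> w \<le> 0" if "w \<in> V" for w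
  proof -
    obtain u where "u \<in> V" "proj A x = a + u"
      using pA A by auto
    then have "proj A x + w \<in> A"
      using subspace_add[OF V(1) _ that] by (auto simp: A add.assoc)
    then show ?thesis
      using any_closest_point_dot[OF A_prop(3,2) pA, of "proj A x + w" x] near by simp
  qed
  show "(x - proj A x) \<bullet> v = 0"
    using le[OF v] le[OF subspace_neg[OF V(1) v]] by simp
qed

lemma translation_eq_at_member:
  assumes "subspace V" "A = (+) a ` V" "p \<in> A"
  shows "y \<in> A \<longleftrightarrow> y - p \<in> V"
proof -
  obtain u where u: "u \<in> V" "p = a + u"
    using assms by auto
  have "y \<in> A \<longleftrightarrow> y - a \<in> V"
    by (auto simp: assms(2) image_iff intro!: bexI[of _ "y - a"])
  also have "\<dots> \<longleftrightarrow> (y - a) - u \<in> V"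
    using subspace_add[OF assms(1) _ u(1), of "y - a - u"] subspace_diff[OF assms(1) _ u(1)] by auto
  also have "(y - a) - u = y - p"
    by (simp add: u(2))
  finally show ?thesis .
qed

lemma parallel_space_eq:
  assumes "subspace V" "A = (+) a ` V"
  shows "{u - w | u w. u \<in> A \<and> w \<in> A} = V"
proof -
  have a: "a \<in> A"
    using subspace_0[OF assms(1)] by (auto simp: assms(2))
  have "u - w \<in> V" if "u \<in> A" "w \<in> A" for u w
    using translation_eq_at_member[OF assms that(2)] that(1) by simp
  moreover have "\<exists>u w. v = u - w \<and> u \<in> A \<and> w \<in> A" if "v \<in> V" for v
    using a that by (intro exI[of _ "a + v"] exI[of _ a]) (simp add: assms(2))
  ultimately show ?thesis
    by blast
qed

lemma proj_hyperplane:
  fixes c :: "'a::real_inner"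
  assumes "c \<noteq> 0"
  shows "proj {x. x \<bullet> c = \<gamma>} y = y + ((\<gamma> - y \<bullet> c) / (c \<bullet> c)) *\<^sub>R c"
proof (rule proj_eqI)
  let ?p = "y + ((\<gamma> - y \<bullet> c) / (c \<bullet> c)) *\<^sub>R c"
  have p: "?p \<bullet> c = \<gamma>"
    using assms by (simp add: inner_add_left)
  then show "?p \<in> {x. x \<bullet> c = \<gamma>}"
    by simp
  fix z assume "z \<in> {x. x \<bullet> c = \<gamma>}"
  then have "(z - ?p) \<bullet> c = 0"
    using p by (simp add: inner_diff_left)
  then have "c \<bullet> (z - ?p) = 0"
    by (subst inner_commute)
  then show "(y - ?p) \<bullet> (z - ?p) = 0"
    by simp
qed

text \<open>For \<open>y \<in> A\<close>, the displacement from \<open>y\<close> to its projection onto the hyperplane is a multiple of \<open>c\<close>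
  and hence orthogonal to \<open>V\<close>, so projecting back onto \<open>A\<close> returns \<open>y\<close>.\<close>

lemma Fix_proj_proj_hyperplane:
  fixes c :: "'a::{real_inner,complete_space}"
  assumes V: "subspace V" "closed V" and A: "A = (+) a ` V"
    and c: "c \<noteq> 0" and orth: "\<And>v. v \<in> V \<Longrightarrow> v \<bullet> c = 0"
  shows "Fix (proj A \<circ> proj {x. x \<bullet> c = \<gamma>}) = A"
proof
  show "Fix (proj A \<circ> proj {x. x \<bullet> c = \<gamma>}) \<subseteq> A"
  proof
    fix y assume "y \<in> Fix (proj A \<circ> proj {x. x \<bullet> c = \<gamma>})"
    then have "y = proj A (proj {x. x \<bullet> c = \<gamma>} y)"
      by (simp add: Fix_def)
    then show "y \<in> A"
      using proj_closed_affine_subspace(1)[OF V A] by metis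
  qed
next
  have "proj A (proj {x. x \<bullet> c = \<gamma>} y) = y" if y: "y \<in> A" for y
  proof (rule proj_eqI[OF y])
    fix z assume "z \<in> A"
    then have "(z - y) \<bullet> c = 0"
      using translation_eq_at_member[OF V(1) A y] orth by blast
    then have "c \<bullet> (z - y) = 0"
      by (subst inner_commute)
    then show "(proj {x. x \<bullet> c = \<gamma>} y - y) \<bullet> (z - y) = 0"
      by (simp add: proj_hyperplane[OF c])
  qed
  then show "A \<subseteq> Fix (proj A \<circ> proj {x. x \<bullet> c = \<gamma>})"
    by (auto simp: Fix_def)
qed

text \<open>The point \<open>q\<close> lies in the hyperplane because \<open>d \<bullet> c = d \<bullet> d\<close>. The difference \<open>x - q\<close> is
  \<open>x - proj A x\<close> minus a multiple of \<open>d\<close>; the first vector is orthogonal to all of \<open>V\<close>, the second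
  to those \<open>v \<in> V\<close> with \<open>v \<bullet> c = 0\<close>, which are the directions of the intersection.\<close>

lemma proj_Int_hyperplane:
  fixes c x :: "'a::{real_inner,complete_space}"
  assumes V: "subspace V" "closed V" and A: "A = (+) a ` V"
    and d: "d \<in> V" "d \<noteq> 0" and vc: "\<And>v. v \<in> V \<Longrightarrow> v \<bullet> c = v \<bullet> d"
    and q: "q = proj A x + ((\<gamma> - proj A x \<bullet> c) / (norm d)\<^sup>2) *\<^sub>R d"
  shows "q \<in> A \<inter> {x. x \<bullet> c = \<gamma>}" and "proj (A \<inter> {x. x \<bullet> c = \<gamma>}) x = q"
proof -
  note pA = proj_closed_affine_subspace[OF V A, where x = x]
  note A_iff = translation_eq_at_member[OF V(1) A]
  have qA: "q \<in> A"
    using A_iff[OF pA(1)] d(1) V(1) by (simp add: q subspace_scale)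
  have "q \<bullet> c = \<gamma>"
    using d by (simp add: q inner_add_left vc power2_norm_eq_inner)
  with qA show qAH: "q \<in> A \<inter> {x. x \<bullet> c = \<gamma>}"
    by simp
  show "proj (A \<inter> {x. x \<bullet> c = \<gamma>}) x = q"
  proof (rule proj_eqI[OF qAH])
    fix y assume y: "y \<in> A \<inter> {x. x \<bullet> c = \<gamma>}"
    then have V': "y - q \<in> V"
      using A_iff[OF qA] by simp
    have "(y - q) \<bullet> d = 0"
      using vc[OF V'] y \<open>q \<bullet> c = \<gamma>\<close> by (simp add: inner_diff_left)
    then have dq: "d \<bullet> (y - q) = 0"
      by (subst inner_commute)
    have xq: "x - q = (x - proj A x) - ((\<gamma> - proj A x \<bullet> c) / (norm d)\<^sup>2) *\<^sub>R d"
      by (simp add: q)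
    show "(x - q) \<bullet> (y - q) = 0"
      unfolding xq inner_diff_left[of "x - proj A x"]
      by (simp only: pA(2)[OF V'] inner_scaleR_left dq mult_zero_right diff_0)
  qed
qed

theorem theorem4p1:
  fixes A U H :: "'a::{real_inner, complete_space} set"
    and c x :: 'a
    and \<gamma> :: real
  assumes A: "closed_affine_subspace A"
    and U: "U = {a - a' | a a'. a \<in> A \<and> a' \<in> A}"
    and c: "c \<noteq> 0"
    and H: "H = {x. x \<bullet> c = \<gamma>}"
  shows "exactly_one3
    (proj U c = 0 \<and> proj A x \<bullet> c = \<gamma> \<and> A \<inter> H \<noteq> {} \<and> proj (A \<inter> H) x = proj A x)
    (proj U c = 0 \<and> proj A x \<bullet> c \<noteq> \<gamma> \<and> A \<inter> H = {} \<and>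
      proj (Fix (proj A \<circ> proj H)) x = proj A x)
    (proj U c \<noteq> 0 \<and> A \<inter> H \<noteq> {} \<and>
      proj (A \<inter> H) x = proj A x + ((\<gamma> - proj A x \<bullet> c) / (norm (proj U c))\<^sup>2) *\<^sub>R proj U c)"
proof -
  obtain a V where V: "subspace V" "closed V" and AV: "A = (+) a ` V"
    using A unfolding closed_affine_subspace_def by auto
  have UV: "U = V"
    using parallel_space_eq[OF V(1) AV] U by simp
  note pA = proj_closed_affine_subspace(1)[OF V AV, of x]
  define d where "d = proj U c"
  \<comment> \<open>\<open>V\<close> is its own translate by \<open>0\<close>, so \<open>d\<close> obeys the same characterization as \<open>proj A x\<close>.\<close>
  have V0: "V = (+) 0 ` V"
    by simp
  have dV: "d \<in> V"
    unfolding d_def UV by (rule proj_closed_affine_subspace(1)[OF V V0])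
  have vc: "v \<bullet> c = v \<bullet> d" if "v \<in> V" for v
    using proj_closed_affine_subspace(2)[OF V V0 that, of c]
    by (simp add: d_def UV inner_commute[of _ v] inner_diff_right)
  show ?thesis
  proof (cases "d = 0")
    case True
    then have orth: "v \<bullet> c = 0" if "v \<in> V" for v
      using vc[OF that] by simp
    have const: "y \<bullet> c = proj A x \<bullet> c" if "y \<in> A" for y
      using orth[of "y - proj A x"] translation_eq_at_member[OF V(1) AV pA] that
      by (simp add: inner_diff_left)
    have "A \<inter> H = (if proj A x \<bullet> c = \<gamma> then A else {})"
      using const by (auto simp: H)
    moreover have "Fix (proj A \<circ> proj H) = A"
      unfolding H by (rule Fix_proj_proj_hyperplane[OF V AV c orth])
    ultimately show ?thesis
      using True pA unfolding exactly_one3_def d_def by auto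
  next
    case False
    let ?q = "proj A x + ((\<gamma> - proj A x \<bullet> c) / (norm d)\<^sup>2) *\<^sub>R d"
    have "?q \<in> A \<inter> H" and "proj (A \<inter> H) x = ?q"
      unfolding H by (rule proj_Int_hyperplane[OF V AV dV False _ refl], erule vc)+
    then have "A \<inter> H \<noteq> {}" and "proj (A \<inter> H) x = ?q"
      by auto
    then show ?thesis
      using False unfolding exactly_one3_def d_def by simp
  qed
qed

end
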